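(* A Frith frame $(L,S)$ is locale-based if and only if for every Frith frame $(M,T)$ and every morphism of Frith frames $h:(L,S)\to(M,T)$ such that $\mathbf L_{\rm Frith}(h)$ is an isomorphism of lattices, $h$ is an isomorphism of Frith frames.
   Context: A Frith frame is a pair $(L,S)$ with $L$ a frame and $S$ a bounded sublattice of $L$ such that every element of $L$ is a join of elements of $S$. A morphism $(L,S)\to(M,T)$ is a frame homomorphism $h:L\to M$ with $h[S]\subseteq T$; $\mathbf L_{\rm Frith}(h):S\to T$ denotes its restriction and co-restriction, a bounded lattice homomorphism. $h$ is an isomorphism if and only if it is injective and $h[S]=T$. A sublocale of a frame $L$ is a subset $K\subseteq L$ closed under arbitrary meets and such that $a\to x\in K$ for all $a\in L$, $x\in K$, where $\to$ is the Heyting implication of $L$. A Frith frame $(L,S)$ is locale-based if the smallest sublocale of $L$ containing $S$ is $L$ itself. *)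

theory Defs
  imports "HOL-Algebra.Complete_Lattice"
begin

section \<open>Frames\<close>

text \<open>Lattices are carrier-based, so that sublocales and sublattices are again objects of the same
  kind and so that one can quantify over all frames carried by a type.\<close>

locale frame = complete_lattice L for L :: "'a gorder" (structure) +
  assumes meet_sup_distrib:
    "\<lbrakk>a \<in> carrier L; B \<subseteq> carrier L\<rbrakk> \<Longrightarrow> a \<sqinter> \<Squnion>B = \<Squnion>((\<lambda>b. a \<sqinter> b) ` B)"

text \<open>The empty set is admitted in \<^const>\<open>sup_pres\<close>, so a frame homomorphism preserves the bottom.\<close>

definition frame_hom :: "'a gorder \<Rightarrow> 'b gorder \<Rightarrow> ('a \<Rightarrow> 'b) \<Rightarrow> bool" where
  "frame_hom L M h \<longleftrightarrow>
     h \<in> carrier L \<rightarrow> carrier M \<and> sup_pres L M h \<and> meet_pres L M h \<and> h \<top>\<^bsub>L\<^esub> = \<top>\<^bsub>M\<^esub>"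

definition heyting :: "'a gorder \<Rightarrow> 'a \<Rightarrow> 'a \<Rightarrow> 'a" where
  "heyting L a x = \<Squnion>\<^bsub>L\<^esub>{c \<in> carrier L. c \<sqinter>\<^bsub>L\<^esub> a \<sqsubseteq>\<^bsub>L\<^esub> x}"

definition is_sublocale :: "'a gorder \<Rightarrow> 'a set \<Rightarrow> bool" where
  "is_sublocale L K \<longleftrightarrow>
     K \<subseteq> carrier L \<and> (\<forall>A\<subseteq>K. \<Sqinter>\<^bsub>L\<^esub>A \<in> K) \<and> (\<forall>a\<in>carrier L. \<forall>x\<in>K. heyting L a x \<in> K)"

definition generated_sublocale :: "'a gorder \<Rightarrow> 'a set \<Rightarrow> 'a set" where
  "generated_sublocale L S = \<Inter>{K. is_sublocale L K \<and> S \<subseteq> K}"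


section \<open>Bounded lattices\<close>

definition bounded_sublattice :: "'a gorder \<Rightarrow> 'a set \<Rightarrow> bool" where
  "bounded_sublattice L S \<longleftrightarrow>
     S \<subseteq> carrier L \<and> \<bottom>\<^bsub>L\<^esub> \<in> S \<and> \<top>\<^bsub>L\<^esub> \<in> S \<and>
     (\<forall>x\<in>S. \<forall>y\<in>S. x \<squnion>\<^bsub>L\<^esub> y \<in> S \<and> x \<sqinter>\<^bsub>L\<^esub> y \<in> S)"

definition bounded_lattice_hom :: "'a gorder \<Rightarrow> 'b gorder \<Rightarrow> ('a \<Rightarrow> 'b) \<Rightarrow> bool" where
  "bounded_lattice_hom X Y f \<longleftrightarrow>
     f \<in> carrier X \<rightarrow> carrier Y \<and> join_pres X Y f \<and> meet_pres X Y f \<and>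
     f \<bottom>\<^bsub>X\<^esub> = \<bottom>\<^bsub>Y\<^esub> \<and> f \<top>\<^bsub>X\<^esub> = \<top>\<^bsub>Y\<^esub>"

definition bounded_lattice_iso :: "'a gorder \<Rightarrow> 'b gorder \<Rightarrow> ('a \<Rightarrow> 'b) \<Rightarrow> bool" where
  "bounded_lattice_iso X Y f \<longleftrightarrow>
     bounded_lattice_hom X Y f \<and>
     (\<exists>g. bounded_lattice_hom Y X g \<and>
          (\<forall>x\<in>carrier X. g (f x) = x) \<and> (\<forall>y\<in>carrier Y. f (g y) = y))"


section \<open>Frith frames\<close>

locale frith_frame = frame L for L :: "'a gorder" (structure) +
  fixes S :: "'a set"
  assumes bounded_sublattice: "bounded_sublattice L S"
    and join_generated: "x \<in> carrier L \<Longrightarrow> \<exists>A\<subseteq>S. x = \<Squnion>A"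

definition frith_hom ::
  "'a gorder \<Rightarrow> 'a set \<Rightarrow> 'b gorder \<Rightarrow> 'b set \<Rightarrow> ('a \<Rightarrow> 'b) \<Rightarrow> bool" where
  "frith_hom L S M T h \<longleftrightarrow> frame_hom L M h \<and> h ` S \<subseteq> T"

definition frith_iso ::
  "'a gorder \<Rightarrow> 'a set \<Rightarrow> 'b gorder \<Rightarrow> 'b set \<Rightarrow> ('a \<Rightarrow> 'b) \<Rightarrow> bool" where
  "frith_iso L S M T h \<longleftrightarrow>
     frith_hom L S M T h \<and>
     (\<exists>g. frith_hom M T L S g \<and>
          (\<forall>x\<in>carrier L. g (h x) = x) \<and> (\<forall>y\<in>carrier M. h (g y) = y))"

text \<open>The functor from Frith frames to bounded lattices, on objects and on morphisms.\<close>

definition frith_lattice :: "'a gorder \<Rightarrow> 'a set \<Rightarrow> 'a gorder" where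
  "frith_lattice L S = L\<lparr>carrier := S\<rparr>"

definition frith_lattice_map :: "'a set \<Rightarrow> ('a \<Rightarrow> 'b) \<Rightarrow> 'a \<Rightarrow> 'b" where
  "frith_lattice_map S h = restrict h S"

definition locale_based :: "'a gorder \<Rightarrow> 'a set \<Rightarrow> bool" where
  "locale_based L S \<longleftrightarrow> generated_sublocale L S = carrier L"


section \<open>Basic facts\<close>

lemma (in frame) heyting_closed: "heyting L a x \<in> carrier L"
  unfolding heyting_def by (rule sup_closed) auto

lemma (in frame) heyting_adjoint:
  assumes "a \<in> carrier L" "x \<in> carrier L" "c \<in> carrier L"
  shows "c \<sqsubseteq> heyting L a x \<longleftrightarrow> c \<sqinter> a \<sqsubseteq> x"
proof
  let ?B = "{c \<in> carrier L. c \<sqinter> a \<sqsubseteq> x}"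
  have B: "?B \<subseteq> carrier L" by auto
  have comm: "b \<sqinter> a = a \<sqinter> b" for b
    by (simp add: meet_def insert_commute)
  have "\<Squnion>((\<lambda>b. a \<sqinter> b) ` ?B) \<sqsubseteq> x"
    using assms comm by (intro sup_least) auto
  then have le: "a \<sqinter> heyting L a x \<sqsubseteq> x"
    by (simp add: heyting_def meet_sup_distrib [OF assms(1) B])
  assume "c \<sqsubseteq> heyting L a x"
  then have "c \<sqinter> a \<sqsubseteq> a \<sqinter> heyting L a x"
    using assms heyting_closed
    by (intro meet_le) (auto intro: le_trans meet_left meet_right)
  then show "c \<sqinter> a \<sqsubseteq> x"
    using le assms heyting_closed by (meson le_trans meet_closed)
next
  assume "c \<sqinter> a \<sqsubseteq> x"
  then show "c \<sqsubseteq> heyting L a x"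
    unfolding heyting_def using assms by (intro sup_upper) auto
qed

lemma (in frame) is_sublocale_carrier: "is_sublocale L (carrier L)"
  unfolding is_sublocale_def using heyting_closed by (auto intro: inf_closed)

text \<open>The intersection defining \<^const>\<open>generated_sublocale\<close> is the smallest sublocale containing
  the given set.\<close>

lemma (in frame) generated_sublocale:
  assumes "S \<subseteq> carrier L"
  shows "is_sublocale L (generated_sublocale L S)"
    and "S \<subseteq> generated_sublocale L S"
    and "\<And>K. is_sublocale L K \<Longrightarrow> S \<subseteq> K \<Longrightarrow> generated_sublocale L S \<subseteq> K"
proof -
  have "generated_sublocale L S \<subseteq> carrier L"
    using is_sublocale_carrier assms unfolding generated_sublocale_def by blast
  moreover have "\<Sqinter>A \<in> generated_sublocale L S" if "A \<subseteq> generated_sublocale L S" for A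
    using that unfolding generated_sublocale_def is_sublocale_def
    by (simp add: subset_eq)
  moreover have "heyting L a x \<in> generated_sublocale L S"
    if "a \<in> carrier L" "x \<in> generated_sublocale L S" for a x
    using that unfolding generated_sublocale_def is_sublocale_def by blast
  ultimately show "is_sublocale L (generated_sublocale L S)"
    unfolding is_sublocale_def by blast
qed (auto simp: generated_sublocale_def)

text \<open>The lattice operations of a bounded sublattice, computed with respect to the restricted order,
  agree with those of the ambient lattice.\<close>

lemma (in frith_frame) frith_lattice_bounded_lattice:
  shows "bounded_lattice (frith_lattice L S)"
    and "\<bottom>\<^bsub>frith_lattice L S\<^esub> = \<bottom>" and "\<top>\<^bsub>frith_lattice L S\<^esub> = \<top>"
    and "\<And>x y. x \<in> S \<Longrightarrow> y \<in> S \<Longrightarrow> x \<squnion>\<^bsub>frith_lattice L S\<^esub> y = x \<squnion> y"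
    and "\<And>x y. x \<in> S \<Longrightarrow> y \<in> S \<Longrightarrow> x \<sqinter>\<^bsub>frith_lattice L S\<^esub> y = x \<sqinter> y"
proof -
  let ?X = "frith_lattice L S"
  have S: "S \<subseteq> carrier L" "\<bottom> \<in> S" "\<top> \<in> S"
    and cl: "\<And>x y. x \<in> S \<Longrightarrow> y \<in> S \<Longrightarrow> x \<squnion> y \<in> S \<and> x \<sqinter> y \<in> S"
    using bounded_sublattice unfolding bounded_sublattice_def by auto
  have X [simp]: "carrier ?X = S" "le ?X = le L" "eq ?X = eq L"
    by (simp_all add: frith_lattice_def)
  have po: "partial_order ?X"
  proof
    show "(.=\<^bsub>?X\<^esub>) = (=)" by (simp add: eq_is_equal)
  qed (use S in \<open>auto simp: eq_is_equal intro: le_trans le_antisym\<close>)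
  then interpret X: partial_order ?X .
  have lub: "is_lub ?X (x \<squnion> y) {x, y}" if "x \<in> S" "y \<in> S" for x y
    using that S cl by (intro least_UpperI)
      (auto simp: Upper_def intro: join_left join_right join_le)
  have glb: "is_glb ?X (x \<sqinter> y) {x, y}" if "x \<in> S" "y \<in> S" for x y
    using that S cl by (intro greatest_LowerI)
      (auto simp: Lower_def intro: meet_left meet_right meet_le)
  have bot: "least ?X \<bottom> S" and top: "greatest ?X \<top> S"
    using S by (auto simp: least_def greatest_def)
  show "bounded_lattice ?X"
  proof
    show "\<exists>s. is_lub ?X s {x, y}" if "x \<in> carrier ?X" "y \<in> carrier ?X" for x y
      using that lub [of x y] by auto
    show "\<exists>s. is_glb ?X s {x, y}" if "x \<in> carrier ?X" "y \<in> carrier ?X" for x y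
      using that glb [of x y] by (intro exI [of _ "x \<sqinter> y"]) simp
    show "\<exists>x. least ?X x (carrier ?X)" "\<exists>x. greatest ?X x (carrier ?X)"
      using bot top by auto
  qed
  show "\<bottom>\<^bsub>?X\<^esub> = \<bottom>"
    unfolding bottom_def [of ?X] using bot X.least_unique by (auto intro!: some_equality)
  show "\<top>\<^bsub>?X\<^esub> = \<top>"
    unfolding top_def [of ?X] using top X.greatest_unique by (auto intro!: some_equality)
  show "x \<squnion>\<^bsub>?X\<^esub> y = x \<squnion> y" if "x \<in> S" "y \<in> S" for x y
    unfolding join_def [of ?X] Lattice.sup_def [of ?X]
    using lub [OF that] X.least_unique by (auto intro!: some_equality)
  show "x \<sqinter>\<^bsub>?X\<^esub> y = x \<sqinter> y" if "x \<in> S" "y \<in> S" for x y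
    unfolding meet_def [of ?X] Lattice.inf_def [of ?X]
    using glb [OF that] X.greatest_unique by (auto intro!: some_equality)
qed

end

theory Submission
  imports Defs
begin

text \<open>Sublocales are the subobjects dual to frame quotients: a sublocale \<open>K\<close> of \<open>L\<close> is itself a frame
  in the induced order, and the reflection of \<open>L\<close> onto \<open>K\<close> is a frame homomorphism; conversely a frame
  homomorphism \<open>h\<close> on \<open>L\<close> determines the sublocale of its saturated elements, those \<open>x\<close> that are the
  largest element of \<open>L\<close> with image below \<open>h x\<close>. Both halves of the theorem are this correspondence.

  Suppose that \<open>L\<close> is locale-based and that \<open>h\<close> restricts to an isomorphism \<open>S \<cong> T\<close>. As \<open>S\<close> generates
  \<open>L\<close> under joins and \<open>h\<close> reflects the order on \<open>S\<close>, every element of \<open>S\<close> is saturated. The sublocale of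
  saturated elements therefore contains \<open>S\<close>, so it is all of \<open>L\<close>, and this says that \<open>h\<close> is an order
  embedding. As \<open>T\<close> generates \<open>M\<close> under joins, \<open>h\<close> is onto; an order isomorphism of frames is an
  isomorphism of frames.

  In the other direction, let \<open>K\<close> be the sublocale generated by \<open>S\<close>. Then \<open>(K, S)\<close> is a Frith frame with
  the same bounded lattice as \<open>(L, S)\<close>, and the reflection \<open>L \<rightarrow> K\<close> fixes \<open>S\<close> pointwise. If it is an
  isomorphism it is injective; being idempotent, it is then the identity, so \<open>K = L\<close>.
  The test frame \<open>K\<close> is a subset of \<open>L\<close>, and so it is carried by the same type.\<close>


section \<open>Suprema, infima and order isomorphisms\<close>

lemma (in complete_lattice) sup_eqI:
  assumes "A \<subseteq> carrier L" "z \<in> carrier L" "\<And>x. x \<in> A \<Longrightarrow> x \<sqsubseteq> z"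
    and "\<And>y. y \<in> carrier L \<Longrightarrow> (\<And>x. x \<in> A \<Longrightarrow> x \<sqsubseteq> y) \<Longrightarrow> z \<sqsubseteq> y"
  shows "\<Squnion>A = z"
proof (rule le_antisym)
  show "\<Squnion>A \<sqsubseteq> z" using assms(1-3) by (rule sup_least)
  show "z \<sqsubseteq> \<Squnion>A" by (rule assms(4)) (use assms(1) sup_upper in auto)
qed (use assms in auto)

lemma (in lattice) meet_eqI:
  assumes "x \<in> carrier L" "y \<in> carrier L" "z \<in> carrier L" "z \<sqsubseteq> x" "z \<sqsubseteq> y"
    and "\<And>w. w \<in> carrier L \<Longrightarrow> w \<sqsubseteq> x \<Longrightarrow> w \<sqsubseteq> y \<Longrightarrow> w \<sqsubseteq> z"
  shows "x \<sqinter> y = z"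
proof (rule le_antisym)
  show "z \<sqsubseteq> x \<sqinter> y" using assms(1-5) by (intro meet_le)
  show "x \<sqinter> y \<sqsubseteq> z" by (rule assms(6)) (use assms(1,2) meet_left meet_right in auto)
qed (use assms in auto)

lemma frame_hom_isotone:
  assumes "frame_hom L M h" "x \<in> carrier L" "y \<in> carrier L" "x \<sqsubseteq>\<^bsub>L\<^esub> y"
  shows "h x \<sqsubseteq>\<^bsub>M\<^esub> h y"
  using assms meet_pres_isotone[of h L M] unfolding frame_hom_def by (blast intro: use_iso2)

text \<open>Suprema, finite infima and the top are determined by the order.\<close>

lemma frame_hom_of_order_iso:
  assumes "frame L" "frame M" and bij: "bij_betw g (carrier L) (carrier M)"
    and ord: "\<And>x y. x \<in> carrier L \<Longrightarrow> y \<in> carrier L \<Longrightarrow> g x \<sqsubseteq>\<^bsub>M\<^esub> g y \<longleftrightarrow> x \<sqsubseteq>\<^bsub>L\<^esub> y"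
  shows "frame_hom L M g"
proof -
  interpret L: frame L by fact
  interpret M: frame M by fact
  have cl: "g x \<in> carrier M" if "x \<in> carrier L" for x
    using bij that by (auto simp: bij_betw_def)
  have onto: "\<exists>x\<in>carrier L. y = g x" if "y \<in> carrier M" for y
    using bij that by (auto simp: bij_betw_def)
  have "\<Squnion>\<^bsub>M\<^esub>(g ` A) = g (\<Squnion>\<^bsub>L\<^esub>A)" if A: "A \<subseteq> carrier L" for A
  proof (rule M.sup_eqI)
    show "g ` A \<subseteq> carrier M" "g (\<Squnion>\<^bsub>L\<^esub>A) \<in> carrier M" using A cl by auto
    show "y \<sqsubseteq>\<^bsub>M\<^esub> g (\<Squnion>\<^bsub>L\<^esub>A)" if "y \<in> g ` A" for y
    proof -
      obtain a where a: "a \<in> A" "y = g a" using \<open>y \<in> g ` A\<close> by blast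
      then have "a \<sqsubseteq>\<^bsub>L\<^esub> \<Squnion>\<^bsub>L\<^esub>A" using A by (intro L.sup_upper)
      then show ?thesis using a A ord by (simp add: subset_iff)
    qed
    fix y assume y: "y \<in> carrier M" and ub: "\<And>z. z \<in> g ` A \<Longrightarrow> z \<sqsubseteq>\<^bsub>M\<^esub> y"
    obtain x where x: "x \<in> carrier L" "y = g x" using onto y by blast
    have "a \<sqsubseteq>\<^bsub>L\<^esub> x" if "a \<in> A" for a
      using ub[of "g a"] ord[of a x] that A x by auto
    then have "\<Squnion>\<^bsub>L\<^esub>A \<sqsubseteq>\<^bsub>L\<^esub> x" using A x by (intro L.sup_least)
    then show "g (\<Squnion>\<^bsub>L\<^esub>A) \<sqsubseteq>\<^bsub>M\<^esub> y" using A x ord by auto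
  qed
  moreover have "g x \<sqinter>\<^bsub>M\<^esub> g y = g (x \<sqinter>\<^bsub>L\<^esub> y)" if xy: "x \<in> carrier L" "y \<in> carrier L" for x y
  proof (rule M.meet_eqI)
    show "g (x \<sqinter>\<^bsub>L\<^esub> y) \<sqsubseteq>\<^bsub>M\<^esub> g x" "g (x \<sqinter>\<^bsub>L\<^esub> y) \<sqsubseteq>\<^bsub>M\<^esub> g y"
      using xy ord L.meet_left L.meet_right by auto
    fix w assume w: "w \<in> carrier M" "w \<sqsubseteq>\<^bsub>M\<^esub> g x" "w \<sqsubseteq>\<^bsub>M\<^esub> g y"
    obtain v where "v \<in> carrier L" "w = g v" using onto w by blast
    then show "w \<sqsubseteq>\<^bsub>M\<^esub> g (x \<sqinter>\<^bsub>L\<^esub> y)" using w xy ord by (auto intro: L.meet_le)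
  qed (use xy cl in auto)
  moreover have "g \<top>\<^bsub>L\<^esub> = \<top>\<^bsub>M\<^esub>"
  proof (rule M.le_antisym)
    obtain x where "x \<in> carrier L" "\<top>\<^bsub>M\<^esub> = g x" using onto M.top_closed by blast
    then show "\<top>\<^bsub>M\<^esub> \<sqsubseteq>\<^bsub>M\<^esub> g \<top>\<^bsub>L\<^esub>" using ord by auto
  qed (use cl in auto)
  ultimately show ?thesis
    using cl unfolding frame_hom_def sup_pres_def meet_pres_def
    by (auto intro: L.complete_lattice_axioms M.complete_lattice_axioms
        L.lattice_axioms M.lattice_axioms)
qed

lemma frith_iso_of_order_embedding:
  assumes L: "frith_frame L S" and M: "frith_frame M T" and h: "frith_hom L S M T h"
    and onto: "h ` carrier L = carrier M" and T: "h ` S = T"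
    and emb: "\<And>x y. x \<in> carrier L \<Longrightarrow> y \<in> carrier L \<Longrightarrow> h x \<sqsubseteq>\<^bsub>M\<^esub> h y \<Longrightarrow> x \<sqsubseteq>\<^bsub>L\<^esub> y"
  shows "frith_iso L S M T h"
proof -
  interpret L: frith_frame L S by fact
  interpret M: frith_frame M T by fact
  have hcl: "h x \<in> carrier M" if "x \<in> carrier L" for x
    using imageI[OF that, of h] by (simp only: onto)
  have inj: "inj_on h (carrier L)"
  proof (rule inj_onI)
    fix x y assume "x \<in> carrier L" "y \<in> carrier L" "h x = h y"
    then show "x = y" using emb[of x y] emb[of y x] hcl[of y] by (intro L.le_antisym) auto
  qed
  have S: "S \<subseteq> carrier L"
    using L.bounded_sublattice by (simp add: bounded_sublattice_def)
  let ?g = "inv_into (carrier L) h"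
  have gh: "?g (h x) = x" if "x \<in> carrier L" for x
    using inj that by (rule inv_into_f_f)
  have hg: "h (?g y) = y" and gcl: "?g y \<in> carrier L" if "y \<in> carrier M" for y
    using f_inv_into_f[of y h "carrier L"] inv_into_into[of y h "carrier L"] that
    by (simp_all only: onto)
  have "frame_hom M L ?g"
  proof (rule frame_hom_of_order_iso[OF M.frame_axioms L.frame_axioms])
    show "bij_betw ?g (carrier M) (carrier L)"
      using inj onto by (intro bij_betw_inv_into) (simp add: bij_betw_def)
    fix x y assume xy: "x \<in> carrier M" "y \<in> carrier M"
    then have "?g x \<sqsubseteq>\<^bsub>L\<^esub> ?g y \<longleftrightarrow> h (?g x) \<sqsubseteq>\<^bsub>M\<^esub> h (?g y)"
      using emb[of "?g x" "?g y"] frame_hom_isotone[of L M h "?g x" "?g y"] gcl h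
      by (auto simp only: frith_hom_def)
    then show "?g x \<sqsubseteq>\<^bsub>L\<^esub> ?g y \<longleftrightarrow> x \<sqsubseteq>\<^bsub>M\<^esub> y" by (simp only: hg xy)
  qed
  moreover have "?g ` T \<subseteq> S"
    unfolding T[symmetric] using S gh by (auto simp: subset_iff)
  ultimately show ?thesis
    using h gh hg unfolding frith_iso_def frith_hom_def by (intro conjI exI[of _ ?g]) simp_all
qed


section \<open>Saturated elements of a frame homomorphism\<close>

text \<open>The fixed points of the composite of \<open>h\<close> with its right adjoint.\<close>

definition saturated :: "'a gorder \<Rightarrow> 'b gorder \<Rightarrow> ('a \<Rightarrow> 'b) \<Rightarrow> 'a set" where
  "saturated L M h = {x \<in> carrier L. \<forall>c\<in>carrier L. h c \<sqsubseteq>\<^bsub>M\<^esub> h x \<longrightarrow> c \<sqsubseteq>\<^bsub>L\<^esub> x}"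

text \<open>Closure under Heyting implication is where the preservation of binary meets enters: if
  \<open>h c \<le> h (a \<rightarrow> x)\<close>, then \<open>h (c \<sqinter> a) \<le> h ((a \<rightarrow> x) \<sqinter> a) \<le> h x\<close>.\<close>

lemma is_sublocale_saturated:
  assumes "frame L" "frame M" and h: "frame_hom L M h"
  shows "is_sublocale L (saturated L M h)"
proof -
  interpret L: frame L by fact
  interpret M: frame M by fact
  have hcl: "h x \<in> carrier M" if "x \<in> carrier L" for x
    using h that by (auto simp: frame_hom_def)
  have hmeet: "h (x \<sqinter>\<^bsub>L\<^esub> y) = h x \<sqinter>\<^bsub>M\<^esub> h y" if "x \<in> carrier L" "y \<in> carrier L" for x y
    using h that by (auto simp: frame_hom_def meet_pres_def)
  note mono = frame_hom_isotone[OF h]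
  have inf: "\<Sqinter>\<^bsub>L\<^esub>A \<in> saturated L M h" if A: "A \<subseteq> saturated L M h" for A
  proof -
    have AL: "A \<subseteq> carrier L" using A by (auto simp: saturated_def)
    have "c \<sqsubseteq>\<^bsub>L\<^esub> \<Sqinter>\<^bsub>L\<^esub>A" if c: "c \<in> carrier L" "h c \<sqsubseteq>\<^bsub>M\<^esub> h (\<Sqinter>\<^bsub>L\<^esub>A)" for c
    proof (rule L.inf_greatest[OF AL c(1)])
      fix a assume a: "a \<in> A"
      then have aL: "a \<in> carrier L" using AL by auto
      have "h (\<Sqinter>\<^bsub>L\<^esub>A) \<sqsubseteq>\<^bsub>M\<^esub> h a"
        using a AL aL by (intro mono) (auto intro: L.inf_lower)
      then have "h c \<sqsubseteq>\<^bsub>M\<^esub> h a"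
        using c hcl aL AL by (meson M.le_trans L.inf_closed)
      then show "c \<sqsubseteq>\<^bsub>L\<^esub> a" using A a c by (auto simp: saturated_def)
    qed
    then show ?thesis using AL by (auto simp: saturated_def)
  qed
  have imp: "heyting L a x \<in> saturated L M h"
    if a: "a \<in> carrier L" and x: "x \<in> saturated L M h" for a x
  proof -
    have xL: "x \<in> carrier L" using x by (auto simp: saturated_def)
    let ?i = "heyting L a x"
    have i: "?i \<in> carrier L" by (rule L.heyting_closed)
    have "c \<sqsubseteq>\<^bsub>L\<^esub> ?i" if c: "c \<in> carrier L" "h c \<sqsubseteq>\<^bsub>M\<^esub> h ?i" for c
    proof -
      have "h c \<sqinter>\<^bsub>M\<^esub> h a \<sqsubseteq>\<^bsub>M\<^esub> h ?i \<sqinter>\<^bsub>M\<^esub> h a"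
        using c a i hcl
        by (intro M.meet_le M.meet_right M.meet_closed)
          (auto intro: M.le_trans[OF M.meet_left])
      then have "h (c \<sqinter>\<^bsub>L\<^esub> a) \<sqsubseteq>\<^bsub>M\<^esub> h (?i \<sqinter>\<^bsub>L\<^esub> a)" using c a i hmeet by simp
      moreover have "?i \<sqinter>\<^bsub>L\<^esub> a \<sqsubseteq>\<^bsub>L\<^esub> x" using L.heyting_adjoint[OF a xL i] i by simp
      then have "h (?i \<sqinter>\<^bsub>L\<^esub> a) \<sqsubseteq>\<^bsub>M\<^esub> h x" using a i xL by (intro mono) auto
      ultimately have "h (c \<sqinter>\<^bsub>L\<^esub> a) \<sqsubseteq>\<^bsub>M\<^esub> h x"
        using a c i xL hcl by (meson M.le_trans L.meet_closed)
      then have "c \<sqinter>\<^bsub>L\<^esub> a \<sqsubseteq>\<^bsub>L\<^esub> x" using a c x by (auto simp: saturated_def)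
      then show ?thesis using L.heyting_adjoint[OF a xL c(1)] by simp
    qed
    then show ?thesis using i by (auto simp: saturated_def)
  qed
  show ?thesis
    unfolding is_sublocale_def using inf imp by (auto simp: saturated_def)
qed

text \<open>Saturation of an element of \<open>S\<close> is a condition on every \<open>c\<close> in \<open>L\<close>, whereas the order is known to
  be reflected only on \<open>S\<close>. Writing \<open>c\<close> as a join of elements of \<open>S\<close> closes the gap.\<close>

lemma subset_saturated:
  assumes "frith_frame L S" "frame M" and h: "frame_hom L M h"
    and refl: "\<And>s t. s \<in> S \<Longrightarrow> t \<in> S \<Longrightarrow> h s \<sqsubseteq>\<^bsub>M\<^esub> h t \<Longrightarrow> s \<sqsubseteq>\<^bsub>L\<^esub> t"
  shows "S \<subseteq> saturated L M h"
proof
  interpret L: frith_frame L S by fact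
  interpret M: frame M by fact
  fix s assume s: "s \<in> S"
  have S: "S \<subseteq> carrier L"
    using L.bounded_sublattice by (simp add: bounded_sublattice_def)
  have hcl: "h x \<in> carrier M" if "x \<in> carrier L" for x
    using h that by (auto simp: frame_hom_def)
  have "c \<sqsubseteq>\<^bsub>L\<^esub> s" if c: "c \<in> carrier L" "h c \<sqsubseteq>\<^bsub>M\<^esub> h s" for c
  proof -
    obtain A where A: "A \<subseteq> S" "c = \<Squnion>\<^bsub>L\<^esub>A" using L.join_generated c by blast
    have "a \<sqsubseteq>\<^bsub>L\<^esub> s" if a: "a \<in> A" for a
    proof (rule refl)
      have aL: "a \<in> carrier L" using a A S by auto
      have "a \<sqsubseteq>\<^bsub>L\<^esub> c" using a A S by (auto intro: L.sup_upper)
      then have "h a \<sqsubseteq>\<^bsub>M\<^esub> h c" using aL c by (intro frame_hom_isotone[OF h])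
      then show "h a \<sqsubseteq>\<^bsub>M\<^esub> h s" using aL c s S hcl by (meson M.le_trans subsetD)
    qed (use a A s in auto)
    then show ?thesis unfolding A(2) using A S s by (intro L.sup_least) auto
  qed
  then show "s \<in> saturated L M h" using s S by (auto simp: saturated_def)
qed

lemma frith_hom_onto:
  assumes "frith_frame L S" "frith_frame M T" and h: "frith_hom L S M T h" and T: "h ` S = T"
  shows "h ` carrier L = carrier M"
proof -
  interpret L: frith_frame L S by fact
  interpret M: frith_frame M T by fact
  have S: "S \<subseteq> carrier L"
    using L.bounded_sublattice by (simp add: bounded_sublattice_def)
  have "y \<in> h ` carrier L" if "y \<in> carrier M" for y
  proof -
    obtain B where "B \<subseteq> T" "y = \<Squnion>\<^bsub>M\<^esub>B" using M.join_generated \<open>y \<in> carrier M\<close> by blast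
    then obtain A where A: "A \<subseteq> S" "y = \<Squnion>\<^bsub>M\<^esub>(h ` A)"
      using T by (metis subset_image_iff)
    then have "A \<subseteq> carrier L" using S by auto
    then have "y = h (\<Squnion>\<^bsub>L\<^esub>A)" "\<Squnion>\<^bsub>L\<^esub>A \<in> carrier L"
      using A h by (auto simp: frith_hom_def frame_hom_def sup_pres_def)
    then show ?thesis by blast
  qed
  then show ?thesis using h by (auto simp: frith_hom_def frame_hom_def)
qed

text \<open>The inverse lattice homomorphism is monotone, which is how the order comes to be reflected.\<close>

lemma frith_lattice_iso_reflects_order:
  assumes L: "frith_frame L S" and M: "frith_frame M T"
    and iso: "bounded_lattice_iso (frith_lattice L S) (frith_lattice M T) (frith_lattice_map S h)"
  shows "h ` S = T"
    and "\<And>s t. s \<in> S \<Longrightarrow> t \<in> S \<Longrightarrow> h s \<sqsubseteq>\<^bsub>M\<^esub> h t \<Longrightarrow> s \<sqsubseteq>\<^bsub>L\<^esub> t"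
proof -
  let ?X = "frith_lattice L S" and ?Y = "frith_lattice M T" and ?f = "frith_lattice_map S h"
  have [simp]: "carrier ?X = S" "carrier ?Y = T" "le ?X = le L" "le ?Y = le M"
    by (simp_all add: frith_lattice_def)
  have [simp]: "?f s = h s" if "s \<in> S" for s using that by (simp add: frith_lattice_map_def)
  obtain g where g: "bounded_lattice_hom ?Y ?X g"
    and gf: "\<And>s. s \<in> S \<Longrightarrow> g (h s) = s" and fg: "\<And>t. t \<in> T \<Longrightarrow> ?f (g t) = t"
    using iso unfolding bounded_lattice_iso_def by auto
  have hT: "h s \<in> T" if "s \<in> S" for s
    using iso that unfolding bounded_lattice_iso_def bounded_lattice_hom_def
    by (auto simp: Pi_iff)
  have gS: "g t \<in> S" if "t \<in> T" for t
    using g that unfolding bounded_lattice_hom_def by auto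
  have "isotone ?Y ?X g"
    using g unfolding bounded_lattice_hom_def by (blast intro: join_pres_isotone)
  then have mono: "g x \<sqsubseteq>\<^bsub>L\<^esub> g y" if "x \<in> T" "y \<in> T" "x \<sqsubseteq>\<^bsub>M\<^esub> y" for x y
    using use_iso2[of ?Y ?X g] that by simp
  show "h ` S = T"
    using hT gS fg by force
  show "s \<sqsubseteq>\<^bsub>L\<^esub> t" if "s \<in> S" "t \<in> S" "h s \<sqsubseteq>\<^bsub>M\<^esub> h t" for s t
    using mono[of "h s" "h t"] that hT gf by simp
qed

lemma locale_based_imp_frith_iso:
  assumes L: "frith_frame L S" and lb: "locale_based L S"
    and M: "frith_frame M T" and h: "frith_hom L S M T h"
    and iso: "bounded_lattice_iso (frith_lattice L S) (frith_lattice M T) (frith_lattice_map S h)"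
  shows "frith_iso L S M T h"
proof (rule frith_iso_of_order_embedding[OF L M h])
  interpret L: frith_frame L S by fact
  interpret M: frith_frame M T by fact
  note ref = frith_lattice_iso_reflects_order[OF L M iso]
  have S: "S \<subseteq> carrier L"
    using L.bounded_sublattice by (simp add: bounded_sublattice_def)
  have hom: "frame_hom L M h" using h by (simp add: frith_hom_def)
  have "generated_sublocale L S \<subseteq> saturated L M h"
    by (rule L.generated_sublocale(3)[OF S is_sublocale_saturated subset_saturated])
      (use L M hom ref in \<open>auto intro: L.frame_axioms M.frame_axioms\<close>)
  then have sat: "carrier L \<subseteq> saturated L M h" using lb by (simp add: locale_based_def)
  show "h ` S = T" by (rule ref)
  then show "h ` carrier L = carrier M" by (rule frith_hom_onto[OF L M h])
  show "x \<sqsubseteq>\<^bsub>L\<^esub> y" if "x \<in> carrier L" "y \<in> carrier L" "h x \<sqsubseteq>\<^bsub>M\<^esub> h y" for x y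
    using sat that by (auto simp: saturated_def)
qed


section \<open>A sublocale as a quotient frame\<close>

definition sublocale_frame :: "'a gorder \<Rightarrow> 'a set \<Rightarrow> 'a gorder" where
  "sublocale_frame L K = L\<lparr>carrier := K\<rparr>"

definition reflection :: "'a gorder \<Rightarrow> 'a set \<Rightarrow> 'a \<Rightarrow> 'a" where
  "reflection L K x = \<Sqinter>\<^bsub>L\<^esub>{k \<in> K. x \<sqsubseteq>\<^bsub>L\<^esub> k}"

lemma sublocale_frame_sel [simp]:
  "carrier (sublocale_frame L K) = K" "le (sublocale_frame L K) = le L"
  "eq (sublocale_frame L K) = eq L"
  by (simp_all add: sublocale_frame_def)

text \<open>Together these facts say that the reflection is left adjoint to the inclusion of \<open>K\<close>.\<close>

lemma (in frame) reflection:
  assumes K: "is_sublocale L K" and x: "x \<in> carrier L"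
  shows reflection_closed: "reflection L K x \<in> K"
    and reflection_upper: "x \<sqsubseteq> reflection L K x"
    and reflection_le_iff: "k \<in> K \<Longrightarrow> reflection L K x \<sqsubseteq> k \<longleftrightarrow> x \<sqsubseteq> k"
proof -
  have KL: "K \<subseteq> carrier L" using K by (simp add: is_sublocale_def)
  then have sub: "{k \<in> K. x \<sqsubseteq> k} \<subseteq> carrier L" by auto
  show cl: "reflection L K x \<in> K"
    using K unfolding reflection_def is_sublocale_def by (simp add: subset_iff)
  show up: "x \<sqsubseteq> reflection L K x"
    unfolding reflection_def using x sub by (intro inf_greatest) auto
  show "reflection L K x \<sqsubseteq> k \<longleftrightarrow> x \<sqsubseteq> k" if k: "k \<in> K"
  proof
    assume "reflection L K x \<sqsubseteq> k"
    then show "x \<sqsubseteq> k" using up x k cl KL by (meson le_trans subsetD)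
  next
    assume "x \<sqsubseteq> k"
    then show "reflection L K x \<sqsubseteq> k"
      unfolding reflection_def using k sub by (intro inf_lower) auto
  qed
qed

lemma (in frame) reflection_fixed:
  assumes K: "is_sublocale L K" and k: "k \<in> K"
  shows "reflection L K k = k"
proof -
  have "k \<in> carrier L" using assms by (auto simp: is_sublocale_def)
  moreover have "reflection L K k \<in> carrier L"
    using reflection_closed[OF K] calculation K by (auto simp: is_sublocale_def)
  ultimately show ?thesis
    using reflection_le_iff[OF K _ k] reflection_upper[OF K] k by (intro le_antisym) auto
qed

lemma (in frame) sublocale_frame_complete_lattice:
  assumes K: "is_sublocale L K"
  shows "complete_lattice (sublocale_frame L K)"
    and sublocale_frame_sup: "A \<subseteq> K \<Longrightarrow> \<Squnion>\<^bsub>sublocale_frame L K\<^esub>A = reflection L K (\<Squnion>A)"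
    and sublocale_frame_meet:
      "x \<in> K \<Longrightarrow> y \<in> K \<Longrightarrow> x \<sqinter>\<^bsub>sublocale_frame L K\<^esub> y = x \<sqinter> y"
    and sublocale_frame_top: "\<top>\<^bsub>sublocale_frame L K\<^esub> = \<top>"
    and top_in_sublocale: "\<top> \<in> K"
proof -
  let ?K = "sublocale_frame L K"
  have KL: "K \<subseteq> carrier L" and inf: "\<And>A. A \<subseteq> K \<Longrightarrow> \<Sqinter>A \<in> K"
    using K by (auto simp: is_sublocale_def)
  interpret K: partial_order ?K
  proof
    show "(.=\<^bsub>?K\<^esub>) = (=)" by (simp add: eq_is_equal)
  qed (use KL in \<open>auto simp: eq_is_equal intro: le_trans le_antisym\<close>)
  have lub: "least ?K (reflection L K (\<Squnion>A)) (Upper ?K A)" if A: "A \<subseteq> K" for A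
  proof (rule least_UpperI)
    have AL: "A \<subseteq> carrier L" and s: "\<Squnion>A \<in> carrier L" using A KL by auto
    show "reflection L K (\<Squnion>A) \<in> carrier ?K" using reflection_closed[OF K s] by simp
    show "x \<sqsubseteq>\<^bsub>?K\<^esub> reflection L K (\<Squnion>A)" if "x \<in> A" for x
      using sup_upper[OF AL that] reflection_upper[OF K s] reflection_closed[OF K s] s KL that AL
      by (auto intro: le_trans)
    show "reflection L K (\<Squnion>A) \<sqsubseteq>\<^bsub>?K\<^esub> y" if "y \<in> Upper ?K A" for y
    proof -
      have y: "y \<in> K" "\<And>x. x \<in> A \<Longrightarrow> x \<sqsubseteq> y" using that A by (auto simp: Upper_def)
      then have "\<Squnion>A \<sqsubseteq> y" using AL KL by (intro sup_least) auto
      then show ?thesis using reflection_le_iff[OF K s y(1)] by simp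
    qed
  qed (use A in auto)
  have glb: "greatest ?K (\<Sqinter>A) (Lower ?K A)" if A: "A \<subseteq> K" for A
    using A inf KL by (intro greatest_LowerI) (auto simp: Lower_def intro!: inf_lower inf_greatest)
  show cK: "complete_lattice ?K"
    by standard (use lub glb in auto)
  interpret K: complete_lattice ?K by (rule cK)
  show "\<Squnion>\<^bsub>?K\<^esub>A = reflection L K (\<Squnion>A)" if "A \<subseteq> K"
    using K.least_unique[OF K.sup_lub lub] that by simp
  show "x \<sqinter>\<^bsub>?K\<^esub> y = x \<sqinter> y" if "x \<in> K" "y \<in> K"
    unfolding meet_def using K.greatest_unique[OF K.inf_glb glb] that by simp
  have "\<Sqinter>{} = \<top>" using weak_inf_empty by (simp add: eq_is_equal)
  then show top: "\<top> \<in> K" using inf[of "{}"] by simp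
  show "\<top>\<^bsub>?K\<^esub> = \<top>"
    using top KL K.top_higher[of \<top>] K.top_closed by (intro le_antisym) auto
qed

text \<open>The suprema of \<open>K\<close> are not those of \<open>L\<close>, so distributivity is not inherited. It holds because
  meeting with \<open>k\<close> has a right adjoint on \<open>K\<close>, the Heyting implication of \<open>L\<close>, whose values at elements
  of \<open>K\<close> stay in \<open>K\<close>.\<close>

lemma (in frame) sublocale_frame_frame:
  assumes K: "is_sublocale L K"
  shows "frame (sublocale_frame L K)"
proof -
  let ?K = "sublocale_frame L K"
  interpret K: complete_lattice ?K by (rule sublocale_frame_complete_lattice[OF K])
  have KL: "K \<subseteq> carrier L" and imp: "\<And>a x. a \<in> carrier L \<Longrightarrow> x \<in> K \<Longrightarrow> heyting L a x \<in> K"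
    using K by (auto simp: is_sublocale_def)
  note meet = sublocale_frame_meet[OF K]
  have "k \<sqinter>\<^bsub>?K\<^esub> \<Squnion>\<^bsub>?K\<^esub>B = \<Squnion>\<^bsub>?K\<^esub>((\<lambda>b. k \<sqinter>\<^bsub>?K\<^esub> b) ` B)" if k: "k \<in> K" and B: "B \<subseteq> K" for k B
  proof -
    have s: "\<Squnion>\<^bsub>?K\<^esub>B \<in> K" using B K.sup_closed[of B] by simp
    have kb: "(\<lambda>b. k \<sqinter>\<^bsub>?K\<^esub> b) ` B \<subseteq> carrier ?K" using k B K.meet_closed by auto
    show ?thesis
    proof (rule K.sup_eqI[OF kb, symmetric])
      show "k \<sqinter>\<^bsub>?K\<^esub> \<Squnion>\<^bsub>?K\<^esub>B \<in> carrier ?K"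
        using K.meet_closed[of k "\<Squnion>\<^bsub>?K\<^esub>B"] k s by simp
      show "x \<sqsubseteq>\<^bsub>?K\<^esub> k \<sqinter>\<^bsub>?K\<^esub> \<Squnion>\<^bsub>?K\<^esub>B" if x: "x \<in> (\<lambda>b. k \<sqinter>\<^bsub>?K\<^esub> b) ` B" for x
      proof -
        obtain b where b: "b \<in> B" "x = k \<sqinter>\<^bsub>?K\<^esub> b" using x by blast
        have "b \<in> K" using b B by auto
        moreover have "b \<sqsubseteq>\<^bsub>?K\<^esub> \<Squnion>\<^bsub>?K\<^esub>B" using K.sup_upper[of B b] b B by simp
        moreover have "k \<sqinter>\<^bsub>?K\<^esub> b \<sqsubseteq>\<^bsub>?K\<^esub> k" "k \<sqinter>\<^bsub>?K\<^esub> b \<sqsubseteq>\<^bsub>?K\<^esub> b" "k \<sqinter>\<^bsub>?K\<^esub> b \<in> carrier ?K"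
          using K.meet_left[of k b] K.meet_right[of k b] K.meet_closed[of k b] k calculation by auto
        ultimately show ?thesis
          unfolding b(2) using K.le_trans[of "k \<sqinter>\<^bsub>?K\<^esub> b" b "\<Squnion>\<^bsub>?K\<^esub>B"] k s
          by (intro K.meet_le) auto
      qed
      fix u assume "u \<in> carrier ?K" and ub: "\<And>x. x \<in> (\<lambda>b. k \<sqinter>\<^bsub>?K\<^esub> b) ` B \<Longrightarrow> x \<sqsubseteq>\<^bsub>?K\<^esub> u"
      then have u: "u \<in> K" by simp
      have "b \<sqsubseteq> heyting L k u" if b: "b \<in> B" for b
      proof -
        have "b \<sqinter> k \<sqsubseteq> u"
          using ub[of "k \<sqinter>\<^bsub>?K\<^esub> b"] b meet[OF k, of b] B by (auto simp: meet_comm[of L b k])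
        then show ?thesis using heyting_adjoint[of k u b] subsetD[OF KL] k u b B by blast
      qed
      then have "\<Squnion>\<^bsub>?K\<^esub>B \<sqsubseteq> heyting L k u"
        using K.sup_least[of B "heyting L k u"] B imp u k KL by auto
      then have "\<Squnion>\<^bsub>?K\<^esub>B \<sqinter> k \<sqsubseteq> u"
        using heyting_adjoint[of k u "\<Squnion>\<^bsub>?K\<^esub>B"] k u s KL by auto
      then show "k \<sqinter>\<^bsub>?K\<^esub> \<Squnion>\<^bsub>?K\<^esub>B \<sqsubseteq>\<^bsub>?K\<^esub> u"
        using meet[OF k s] by (simp add: meet_comm[of L k])
    qed
  qed
  then show ?thesis
    by unfold_locales simp
qed

text \<open>A left adjoint preserves suprema. For binary meets, the implications \<open>y \<rightarrow> r (x \<sqinter> y)\<close> and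
  \<open>r x \<rightarrow> r (x \<sqinter> y)\<close> belong to \<open>K\<close>, so that \<open>x\<close> and then \<open>y\<close> may be replaced by its reflection below
  them.\<close>

lemma (in frame) frame_hom_reflection:
  assumes K: "is_sublocale L K"
  shows "frame_hom L (sublocale_frame L K) (reflection L K)"
proof -
  let ?K = "sublocale_frame L K" and ?r = "reflection L K"
  interpret K: frame ?K by (rule sublocale_frame_frame[OF K])
  have KL: "K \<subseteq> carrier L" and imp: "\<And>a x. a \<in> carrier L \<Longrightarrow> x \<in> K \<Longrightarrow> heyting L a x \<in> K"
    using K by (auto simp: is_sublocale_def)
  note rK = reflection_closed[OF K] and ru = reflection_upper[OF K] and rle = reflection_le_iff[OF K]
  have rL: "?r x \<in> carrier L" if "x \<in> carrier L" for x using rK[OF that] KL by auto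
  have mono: "?r x \<sqsubseteq> ?r y" if "x \<in> carrier L" "y \<in> carrier L" "x \<sqsubseteq> y" for x y
  proof -
    have "x \<sqsubseteq> ?r y" using le_trans[OF that(3) ru] that rL by auto
    then show ?thesis using rle rK that by blast
  qed
  have "\<Squnion>\<^bsub>?K\<^esub>(?r ` A) = ?r (\<Squnion>A)" if A: "A \<subseteq> carrier L" for A
  proof (rule K.sup_eqI)
    show "?r ` A \<subseteq> carrier ?K" "?r (\<Squnion>A) \<in> carrier ?K" using A rK by auto
    show "x \<sqsubseteq>\<^bsub>?K\<^esub> ?r (\<Squnion>A)" if "x \<in> ?r ` A" for x
      using that A by (auto intro!: mono sup_upper)
    fix y assume "y \<in> carrier ?K" and ub: "\<And>x. x \<in> ?r ` A \<Longrightarrow> x \<sqsubseteq>\<^bsub>?K\<^esub> y"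
    then have y: "y \<in> K" by simp
    have "x \<sqsubseteq> y" if "x \<in> A" for x
      using ub[of "?r x"] rle[OF _ y, of x] that A by auto
    then have "\<Squnion>A \<sqsubseteq> y" using A y KL by (intro sup_least) auto
    then show "?r (\<Squnion>A) \<sqsubseteq>\<^bsub>?K\<^esub> y" using rle A y by simp
  qed
  moreover have "?r (x \<sqinter> y) = ?r x \<sqinter>\<^bsub>?K\<^esub> ?r y" if xy: "x \<in> carrier L" "y \<in> carrier L" for x y
  proof -
    let ?m = "?r (x \<sqinter> y)"
    have m: "?m \<in> K" "?m \<in> carrier L" using rK rL xy by auto
    have "x \<sqinter> y \<sqsubseteq> ?m" using ru xy by simp
    then have "x \<sqsubseteq> heyting L y ?m" using heyting_adjoint xy m by simp
    then have "?r x \<sqsubseteq> heyting L y ?m" using rle imp xy m by simp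
    then have "y \<sqinter> ?r x \<sqsubseteq> ?m"
      using heyting_adjoint[of y ?m "?r x"] xy m rL by (simp add: meet_comm)
    then have "y \<sqsubseteq> heyting L (?r x) ?m" using heyting_adjoint xy m rL by simp
    then have "?r y \<sqsubseteq> heyting L (?r x) ?m" using rle imp xy m rL by simp
    then have le: "?r x \<sqinter> ?r y \<sqsubseteq> ?m"
      using heyting_adjoint[of "?r x" ?m "?r y"] xy m rL by (simp add: meet_comm)
    have "?m \<sqsubseteq> ?r x \<sqinter> ?r y"
      using xy m rL by (intro meet_le mono) (auto intro: meet_left meet_right)
    then have "?m = ?r x \<sqinter> ?r y" using le xy rL by (intro le_antisym) auto
    then show ?thesis using sublocale_frame_meet[OF K] rK xy by simp
  qed
  moreover have "?r \<top> = \<top>\<^bsub>?K\<^esub>"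
    using reflection_fixed[OF K] sublocale_frame_top[OF K] top_in_sublocale[OF K] by simp
  ultimately show ?thesis
    using rK unfolding frame_hom_def sup_pres_def meet_pres_def
    by (auto intro: complete_lattice_axioms lattice_axioms K.complete_lattice_axioms K.lattice_axioms)
qed

text \<open>Joins of elements of \<open>S\<close> that lie in \<open>K\<close> are not changed by the reflection, so \<open>S\<close> is still a
  bounded sublattice of \<open>K\<close> and still generates it.\<close>

lemma (in frith_frame) frith_frame_sublocale_frame:
  assumes K: "is_sublocale L K" and SK: "S \<subseteq> K"
  shows "frith_frame (sublocale_frame L K) S"
proof -
  let ?K = "sublocale_frame L K"
  interpret K: frame ?K by (rule sublocale_frame_frame[OF K])
  have KL: "K \<subseteq> carrier L" using K by (auto simp: is_sublocale_def)
  have S: "\<bottom> \<in> S" "\<top> \<in> S" "\<And>x y. x \<in> S \<Longrightarrow> y \<in> S \<Longrightarrow> x \<squnion> y \<in> S \<and> x \<sqinter> y \<in> S"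
    using bounded_sublattice by (auto simp: bounded_sublattice_def)
  have sup: "\<Squnion>\<^bsub>?K\<^esub>A = \<Squnion>A" if "A \<subseteq> K" "\<Squnion>A \<in> K" for A
    using that sublocale_frame_sup[OF K] reflection_fixed[OF K] by simp
  have join: "x \<squnion>\<^bsub>?K\<^esub> y = x \<squnion> y" if "x \<in> S" "y \<in> S" for x y
    using sup[of "{x, y}"] that S SK unfolding join_def by auto
  have meet: "x \<sqinter>\<^bsub>?K\<^esub> y = x \<sqinter> y" if "x \<in> S" "y \<in> S" for x y
    using sublocale_frame_meet[OF K] that SK by auto
  have bot: "\<bottom>\<^bsub>?K\<^esub> = \<bottom>"
  proof (rule le_antisym)
    show "\<bottom>\<^bsub>?K\<^esub> \<sqsubseteq> \<bottom>" using K.bottom_lower[of \<bottom>] S(1) SK by auto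
    have "\<bottom>\<^bsub>?K\<^esub> \<in> carrier L" using K.bottom_closed KL by auto
    then show "\<bottom> \<sqsubseteq> \<bottom>\<^bsub>?K\<^esub>" "\<bottom>\<^bsub>?K\<^esub> \<in> carrier L" by simp_all
  qed (rule bottom_closed)
  have "bounded_sublattice ?K S"
    unfolding bounded_sublattice_def
    using S SK by (simp add: bot join meet sublocale_frame_top[OF K])
  moreover have "\<exists>A\<subseteq>S. x = \<Squnion>\<^bsub>?K\<^esub>A" if x: "x \<in> K" for x
  proof -
    obtain A where A: "A \<subseteq> S" "x = \<Squnion>A" using join_generated[of x] x KL by blast
    then have "\<Squnion>\<^bsub>?K\<^esub>A = \<Squnion>A" using x SK by (intro sup) simp_all
    then show ?thesis using A by (intro exI[of _ A]) simp
  qed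
  ultimately show ?thesis by unfold_locales simp_all
qed

lemma bounded_lattice_iso_ident:
  assumes "bounded_lattice X" and f: "\<And>x. x \<in> carrier X \<Longrightarrow> f x = x"
  shows "bounded_lattice_iso X X f"
proof -
  interpret bounded_lattice X by fact
  have "bounded_lattice_hom X X f"
    using f lattice_axioms
    by (auto simp: bounded_lattice_hom_def join_pres_def meet_pres_def)
  moreover have "bounded_lattice_hom X X id"
    using lattice_axioms by (auto simp: bounded_lattice_hom_def join_pres_def meet_pres_def)
  ultimately show ?thesis using f unfolding bounded_lattice_iso_def by (metis id_apply)
qed

lemma (in frith_frame) locale_based_if_reflection_iso:
  assumes "\<And>M T h. frith_frame M T \<Longrightarrow> frith_hom L S M T h \<Longrightarrow>
      bounded_lattice_iso (frith_lattice L S) (frith_lattice M T) (frith_lattice_map S h) \<Longrightarrow>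
      frith_iso L S M T (h :: 'a \<Rightarrow> 'a)"
  shows "locale_based L S"
proof -
  let ?K = "generated_sublocale L S"
  let ?M = "sublocale_frame L ?K" and ?r = "reflection L ?K"
  have S: "S \<subseteq> carrier L"
    using bounded_sublattice by (simp add: bounded_sublattice_def)
  note K = generated_sublocale(1)[OF S] and SK = generated_sublocale(2)[OF S]
  have KL: "?K \<subseteq> carrier L" using K by (simp add: is_sublocale_def)
  have fix_S: "?r s = s" if "s \<in> S" for s using reflection_fixed[OF K] SK that by auto
  have "frith_lattice ?M S = frith_lattice L S"
    by (simp add: frith_lattice_def sublocale_frame_def)
  moreover have "bounded_lattice_iso (frith_lattice L S) (frith_lattice L S) (frith_lattice_map S ?r)"
    by (rule bounded_lattice_iso_ident[OF frith_lattice_bounded_lattice(1)])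
      (simp add: frith_lattice_def frith_lattice_map_def fix_S)
  moreover have "frith_hom L S ?M S ?r"
    using frame_hom_reflection[OF K] fix_S by (auto simp: frith_hom_def)
  ultimately have "frith_iso L S ?M S ?r"
    using assms frith_frame_sublocale_frame[OF K SK] by simp
  then have inj: "inj_on ?r (carrier L)"
    unfolding frith_iso_def by (metis inj_on_def)
  \<comment> \<open>An injective idempotent map is the identity.\<close>
  have "x \<in> ?K" if x: "x \<in> carrier L" for x
  proof -
    have "?r x \<in> ?K" by (rule reflection_closed[OF K x])
    moreover from this have "?r (?r x) = ?r x" by (rule reflection_fixed[OF K])
    ultimately show ?thesis using inj x KL by (metis inj_onD subsetD)
  qed
  then show ?thesis using KL unfolding locale_based_def by auto
qed


section \<open>Characterisation of locale-based Frith frames\<close>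

theorem proposition6p9:
  fixes L :: "'a gorder" and S :: "'a set"
  assumes "frith_frame L S"
  shows "(locale_based L S \<longleftrightarrow>
           (\<forall>(M :: 'a gorder) (T :: 'a set) (h :: 'a \<Rightarrow> 'a).
              frith_frame M T \<and> frith_hom L S M T h \<and>
              bounded_lattice_iso (frith_lattice L S) (frith_lattice M T) (frith_lattice_map S h)
              \<longrightarrow> frith_iso L S M T h))
       \<and> (locale_based L S \<longrightarrow>
           (\<forall>(M :: 'b gorder) (T :: 'b set) (h :: 'a \<Rightarrow> 'b).
              frith_frame M T \<and> frith_hom L S M T h \<and>
              bounded_lattice_iso (frith_lattice L S) (frith_lattice M T) (frith_lattice_map S h)
              \<longrightarrow> frith_iso L S M T h))"
proof (intro conjI iffI allI impI; (elim conjE)?)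
  show "locale_based L S"
    if "\<forall>(M :: 'a gorder) (T :: 'a set) (h :: 'a \<Rightarrow> 'a). frith_frame M T \<and> frith_hom L S M T h \<and>
          bounded_lattice_iso (frith_lattice L S) (frith_lattice M T) (frith_lattice_map S h)
          \<longrightarrow> frith_iso L S M T h"
    using that by (intro frith_frame.locale_based_if_reflection_iso[OF assms]) blast
qed (fact locale_based_imp_frith_iso[OF assms])+

end
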